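(* Let $N \ge 1$ be an integer, let $x_0,\ldots,x_{N-1}\in\mathbb{R}$ be the Gauss--Hermite quadrature nodes of degree $N$ (the $N$ roots of the Hermite function $\psi_N$), and let $T\in\mathbb{R}^{N\times N}$ be the Hermite transform matrix with entries $T_{ij}=\psi_j(x_i)$ for $0\le i,j\le N-1$. Then $$T = DQ^T,\qquad T^{-1} = QD^{-1},$$ where $Q\in\mathbb{R}^{N\times N}$ is orthogonal and $D\in\mathbb{R}^{N\times N}$ is diagonal, with $$Q_{kj} = \frac{\psi_k(x_j)}{\sqrt{N}\,|\psi_{N-1}(x_j)|},\qquad D_{jj}=\sqrt{N}\,|\psi_{N-1}(x_j)|,\qquad 0\le k,j\le N-1.$$
   Context: All matrix and vector indices run from $0$ to $N-1$. The Hermite polynomials $\mathrm{H}_n$ are defined by $\mathrm{H}_0(x)=1$, $\mathrm{H}_1(x)=2x$, and $\mathrm{H}_{n+1}(x)=2x\,\mathrm{H}_n(x)-2n\,\mathrm{H}_{n-1}(x)$ for $n\ge 1$. The Hermite functions are $\psi_n(x)=(2^n n!\sqrt{\pi})^{-1/2}\,\mathrm{e}^{-x^2/2}\,\mathrm{H}_n(x)$ for $n\ge 0$; they form an orthonormal basis of $L^2(\mathbb{R})$. The Gauss--Hermite quadrature nodes of degree $N$ are the $N$ distinct real roots of $\psi_N$ (equivalently of $\mathrm{H}_N$), enumerated as $x_0,\ldots,x_{N-1}$. *)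

theory Defs
  imports
    Complex_Main
    "HOL-Computational_Algebra.Polynomial"
    "Jordan_Normal_Form.Matrix"
begin

fun hermite_poly :: "nat \<Rightarrow> real poly" where
  "hermite_poly 0 = 1"
| "hermite_poly (Suc 0) = [:0, 2:]"
| "hermite_poly (Suc (Suc n)) =
     [:0, 2:] * hermite_poly (Suc n) - Polynomial.smult (2 * real (Suc n)) (hermite_poly n)"

definition hermite_fun :: "nat \<Rightarrow> real \<Rightarrow> real" where
  "hermite_fun n t =
     (2 ^ n * fact n * sqrt pi) powr (- 1 / 2) * exp (- t\<^sup>2 / 2) * poly (hermite_poly n) t"

(* The enumeration may be in any order; being a bijection onto the full set of
   real zeros, it also says that these zeros are exactly N in number. *)
definition gauss_hermite_nodes :: "nat \<Rightarrow> (nat \<Rightarrow> real) \<Rightarrow> bool" where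
  "gauss_hermite_nodes N x \<longleftrightarrow> bij_betw x {..<N} {t. hermite_fun N t = 0}"

definition hermite_T :: "nat \<Rightarrow> (nat \<Rightarrow> real) \<Rightarrow> real mat" where
  "hermite_T N x = mat N N (\<lambda>(i, j). hermite_fun j (x i))"

definition hermite_Q :: "nat \<Rightarrow> (nat \<Rightarrow> real) \<Rightarrow> real mat" where
  "hermite_Q N x =
     mat N N (\<lambda>(k, j). hermite_fun k (x j) / (sqrt (real N) * \<bar>hermite_fun (N - 1) (x j)\<bar>))"

definition hermite_D :: "nat \<Rightarrow> (nat \<Rightarrow> real) \<Rightarrow> real mat" where
  "hermite_D N x =
     mat N N (\<lambda>(i, j). if i = j then sqrt (real N) * \<bar>hermite_fun (N - 1) (x j)\<bar> else 0)"

(* The constant orthogonal_mat of Jordan_Normal_Form only asks for nonzero, pairwise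
   orthogonal columns, without normalization; this is the usual notion. *)
definition real_orthogonal_mat :: "real mat \<Rightarrow> bool" where
  "real_orthogonal_mat A \<longleftrightarrow>
     square_mat A \<and> inverts_mat A (transpose_mat A) \<and> inverts_mat (transpose_mat A) A"

(* Meaningful only if invertible_mat A holds; the inverse is then unique. *)
definition inv_mat :: "real mat \<Rightarrow> real mat" where
  "inv_mat A = (THE B. inverts_mat A B \<and> inverts_mat B A)"

end

theory Submission
  imports Defs "Jordan_Normal_Form.Determinant"
begin

text \<open>
  Up to the common factor \<open>exp (- (a\<^sup>2 + b\<^sup>2) / 2) / sqrt pi\<close>, the inner product of the
  vectors \<open>(\<psi>\<^sub>k(a))\<close> and \<open>(\<psi>\<^sub>k(b))\<close>, \<open>k < N\<close>, is the Christoffel--Darboux kernel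
  \<open>\<Sum>k<N. H\<^sub>k(a) H\<^sub>k(b) / (2^k k!)\<close>. The three-term recurrence makes this sum telescope.
  For \<open>a \<noteq> b\<close> the closed form is a multiple of
  \<open>H\<^sub>N(a) H\<^sub>N\<^sub>-\<^sub>1(b) - H\<^sub>N\<^sub>-\<^sub>1(a) H\<^sub>N(b)\<close>, which vanishes at two nodes
  (\<open>christoffel_darboux\<close>). For a node \<open>a = b\<close>, the limiting closed form makes the
  squared norm of the vector equal to \<open>N \<psi>\<^sub>N\<^sub>-\<^sub>1(a)\<^sup>2\<close> (\<open>christoffel_darboux_diagonal\<close>).
  Hence the rows of \<open>T\<close>, which are these vectors at the nodes, are pairwise orthogonal
  with norms \<open>d\<^sub>j = sqrt N * \<bar>\<psi>\<^sub>N\<^sub>-\<^sub>1(x\<^sub>j)\<bar>\<close>.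

  These norms are positive because the first component \<open>\<psi>\<^sub>0\<close> never vanishes. Dividing each
  row by its norm gives \<open>T = D Q\<^sup>T\<close> with orthonormal columns in \<open>Q\<close>. As \<open>Q\<close> is square, it is
  orthogonal, and the formula for the inverse follows.
\<close>

lemma poly_hermite_Suc_Suc:
  "poly (hermite_poly (Suc (Suc n))) t =
     2 * t * poly (hermite_poly (Suc n)) t - 2 * real (Suc n) * poly (hermite_poly n) t"
  by simp

lemma christoffel_darboux:
  fixes a b :: real
  shows "(a - b) * (\<Sum>k\<le>n. poly (hermite_poly k) a * poly (hermite_poly k) b / (2 ^ k * fact k))
    = (poly (hermite_poly (Suc n)) a * poly (hermite_poly n) b
       - poly (hermite_poly n) a * poly (hermite_poly (Suc n)) b) / (2 ^ Suc n * fact n)"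
proof (induction n)
  case 0
  show ?case by (simp add: algebra_simps)
next
  case (Suc n)
  have c: "(2::real) ^ Suc n * fact n \<noteq> 0" by simp
  have f: "(2::real) ^ Suc n * fact (Suc n) = real (Suc n) * (2 ^ Suc n * fact n)"
    "(2::real) ^ Suc (Suc n) * fact (Suc n) = 2 * real (Suc n) * (2 ^ Suc n * fact n)"
    by (simp_all add: algebra_simps)
  define m where "m = real (Suc n)"
  have m: "m \<noteq> 0" by (simp add: m_def)
  have step: "(q * p' - p * q') / c + (a - b) * (q * q' / (m * c)) =
      ((2 * a * q - 2 * m * p) * q' - q * (2 * b * q' - 2 * m * p')) / (2 * m * c)"
    if "c \<noteq> 0" "m \<noteq> 0" for p p' q q' c m :: real
    using that by (simp add: field_simps)
  show ?case
    unfolding sum.atMost_Suc distrib_left Suc.IH poly_hermite_Suc_Suc f m_def[symmetric]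
    by (rule step[OF c m])
qed

text \<open>The limit as \<open>b \<rightarrow> a\<close> of \<open>christoffel_darboux\<close> divided by \<open>a - b\<close>. Its numerator usually reads
  \<open>(n + 1) H\<^sub>n\<^sup>2 - n H\<^sub>n\<^sub>+\<^sub>1 H\<^sub>n\<^sub>-\<^sub>1\<close>; eliminating \<open>n H\<^sub>n\<^sub>-\<^sub>1\<close> by the
  recurrence gives a form that also makes sense at \<open>n = 0\<close>, so that induction proves it
  without derivatives.\<close>

lemma christoffel_darboux_diagonal:
  fixes t :: real
  shows "(\<Sum>k\<le>n. (poly (hermite_poly k) t)\<^sup>2 / (2 ^ k * fact k))
    = (real (Suc n) * (poly (hermite_poly n) t)\<^sup>2
       - t * poly (hermite_poly n) t * poly (hermite_poly (Suc n)) t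
       + (poly (hermite_poly (Suc n)) t)\<^sup>2 / 2) / (2 ^ n * fact n)"
proof (induction n)
  case 0
  show ?case by (simp add: power2_eq_square)
next
  case (Suc n)
  have c: "(2::real) ^ n * fact n \<noteq> 0" by simp
  have f: "(2::real) ^ Suc n * fact (Suc n) = 2 * real (Suc n) * (2 ^ n * fact n)"
    by (simp add: algebra_simps)
  define m where "m = real (Suc n)"
  have m: "m \<noteq> 0" "real (Suc (Suc n)) = m + 1" by (simp_all add: m_def)
  have step: "(m * p\<^sup>2 - t * p * q + q\<^sup>2 / 2) / c + q\<^sup>2 / (2 * m * c) =
      ((m + 1) * q\<^sup>2 - t * q * (2 * t * q - 2 * m * p)
       + (2 * t * q - 2 * m * p)\<^sup>2 / 2) / (2 * m * c)"
    if "c \<noteq> 0" "m \<noteq> 0" for p q c m :: real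
    using that by (simp add: field_simps power2_eq_square)
  show ?case
    unfolding sum.atMost_Suc Suc.IH poly_hermite_Suc_Suc f m_def[symmetric] m(2)
    by (rule step[OF c m(1)])
qed

lemma hermite_fun_eq_0_iff: "hermite_fun n t = 0 \<longleftrightarrow> poly (hermite_poly n) t = 0"
  by (simp add: hermite_fun_def)

lemma hermite_fun_mult:
  "hermite_fun k a * hermite_fun k b =
     exp (- a\<^sup>2 / 2) * exp (- b\<^sup>2 / 2) / sqrt pi *
       (poly (hermite_poly k) a * poly (hermite_poly k) b / (2 ^ k * fact k))"
proof -
  define c :: real where "c = 2 ^ k * fact k * sqrt pi"
  have "c > 0" by (simp add: c_def)
  then have r: "c powr (- 1 / 2) * c powr (- 1 / 2) = 1 / c"
    by (simp add: powr_add[symmetric] powr_minus_divide)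
  have "hermite_fun k a * hermite_fun k b =
      (c powr (- 1 / 2) * c powr (- 1 / 2)) * (exp (- a\<^sup>2 / 2) * exp (- b\<^sup>2 / 2)
        * (poly (hermite_poly k) a * poly (hermite_poly k) b))"
    by (simp only: hermite_fun_def c_def mult_ac)
  then show ?thesis unfolding r by (simp add: c_def del: hermite_poly.simps)
qed

lemma sum_hermite_fun_mult:
  "(\<Sum>k\<in>A. hermite_fun k a * hermite_fun k b) =
     exp (- a\<^sup>2 / 2) * exp (- b\<^sup>2 / 2) / sqrt pi *
       (\<Sum>k\<in>A. poly (hermite_poly k) a * poly (hermite_poly k) b / (2 ^ k * fact k))"
  unfolding hermite_fun_mult sum_distrib_left by (rule refl)

lemma sum_hermite_fun_mult_eq_0:
  assumes "hermite_fun (Suc n) a = 0" "hermite_fun (Suc n) b = 0" "a \<noteq> b"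
  shows "(\<Sum>k\<le>n. hermite_fun k a * hermite_fun k b) = 0"
  using christoffel_darboux[of a b n] assms
  by (simp add: hermite_fun_eq_0_iff sum_hermite_fun_mult del: hermite_poly.simps)

lemma sum_hermite_fun_square:
  assumes "hermite_fun (Suc n) t = 0"
  shows "(\<Sum>k\<le>n. hermite_fun k t * hermite_fun k t) = real (Suc n) * (hermite_fun n t)\<^sup>2"
  using christoffel_darboux_diagonal[of t n] assms
  unfolding power2_eq_square[of "hermite_fun n t"] sum_hermite_fun_mult
  unfolding hermite_fun_mult
  by (simp add: hermite_fun_eq_0_iff power2_eq_square del: hermite_poly.simps)

text \<open>A common zero of \<open>\<psi>\<^sub>n\<close> and \<open>\<psi>\<^sub>n\<^sub>+\<^sub>1\<close> would annihilate the whole sum of squares,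
  including the Gaussian \<open>\<psi>\<^sub>0\<close>. This makes \<open>D\<close> invertible.\<close>

lemma hermite_fun_consecutive_no_common_zero:
  assumes "hermite_fun (Suc n) t = 0"
  shows "hermite_fun n t \<noteq> 0"
proof
  assume "hermite_fun n t = 0"
  then have "(\<Sum>k\<le>n. hermite_fun k t * hermite_fun k t) = 0"
    using sum_hermite_fun_square[OF assms] by simp
  then have "hermite_fun 0 t * hermite_fun 0 t = 0"
    by (subst (asm) sum_nonneg_eq_0_iff) auto
  then show False by (simp add: hermite_fun_def)
qed

lemma inv_mat_eqI:
  assumes "A \<in> carrier_mat n n" "B \<in> carrier_mat n n" "A * B = 1\<^sub>m n" "B * A = 1\<^sub>m n"
  shows "inv_mat A = B"
  unfolding inv_mat_def
proof (rule the_equality)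
  show "inverts_mat A B \<and> inverts_mat B A"
    using assms by (simp add: inverts_mat_def)
next
  fix C assume C: "inverts_mat A C \<and> inverts_mat C A"
  \<comment> \<open>The two equations determine the dimensions of \<open>C\<close>, on which \<open>THE\<close> puts no constraint.\<close>
  have "A * C = 1\<^sub>m n" "C * A = 1\<^sub>m (dim_row C)"
    using C assms(1) by (auto simp: inverts_mat_def)
  then have "dim_col C = n" "dim_row C = n"
    using assms(1) by (metis index_mult_mat(3) index_one_mat(3) carrier_matD(2))+
  then have carrier: "C \<in> carrier_mat n n" by blast
  have "C = C * (A * B)" using carrier assms by simp
  also have "\<dots> = (C * A) * B" using carrier assms by (simp add: assoc_mult_mat)
  also have "\<dots> = B" using C carrier assms by (simp add: inverts_mat_def)
  finally show "C = B" .
qed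

lemma diag_mult_mat:
  fixes f :: "nat \<Rightarrow> 'a :: semiring_0"
  assumes "A \<in> carrier_mat n m"
  shows "mat n n (\<lambda>(i, j). if i = j then f j else 0) * A = mat n m (\<lambda>(i, j). f i * A $$ (i, j))"
  using assms by (intro eq_matI) (auto simp: scalar_prod_def if_distrib if_distribR cong: if_cong)

theorem lemma2p1:
  fixes N :: nat and x :: "nat \<Rightarrow> real"
  assumes "N \<ge> 1"
    and "gauss_hermite_nodes N x"
  shows "real_orthogonal_mat (hermite_Q N x)
    \<and> diagonal_mat (hermite_D N x)
    \<and> hermite_T N x = hermite_D N x * transpose_mat (hermite_Q N x)
    \<and> invertible_mat (hermite_T N x)
    \<and> invertible_mat (hermite_D N x)
    \<and> inv_mat (hermite_T N x) = hermite_Q N x * inv_mat (hermite_D N x)"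
proof -
  obtain n where N: "N = Suc n" using assms(1) by (cases N) auto
  let ?T = "hermite_T N x" and ?Q = "hermite_Q N x" and ?D = "hermite_D N x"
  define d where "d j = sqrt (real N) * \<bar>hermite_fun n (x j)\<bar>" for j
  define E where "E = mat N N (\<lambda>(i, j). if i = j then 1 / d j else 0)"
  have zero: "hermite_fun (Suc n) (x j) = 0" if "j < N" for j
    using assms(2) that by (auto simp: gauss_hermite_nodes_def bij_betw_def N)
  have distinct: "x i \<noteq> x j" if "i < N" "j < N" "i \<noteq> j" for i j
    using assms(2) that by (auto simp: gauss_hermite_nodes_def bij_betw_def inj_on_def)
  have d_nz: "d j \<noteq> 0" if "j < N" for j
    using hermite_fun_consecutive_no_common_zero[OF zero[OF that]] by (simp add: d_def N)
  have inner: "(\<Sum>k\<in>{0..<N}. hermite_fun k (x i) * hermite_fun k (x j)) =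
      (if i = j then d j * d j else 0)" if "i < N" "j < N" for i j
  proof -
    have "{0..<N} = {..n}" by (auto simp: N)
    moreover have "d j * d j = real (Suc n) * (hermite_fun n (x j))\<^sup>2"
      by (simp add: d_def N power2_eq_square algebra_simps)
    ultimately show ?thesis
      using that zero distinct sum_hermite_fun_mult_eq_0 sum_hermite_fun_square by auto
  qed
  have carrier: "?T \<in> carrier_mat N N" "?Q \<in> carrier_mat N N" "?D \<in> carrier_mat N N"
      "E \<in> carrier_mat N N"
    by (simp_all add: hermite_T_def hermite_Q_def hermite_D_def E_def)
  have Q: "?Q = mat N N (\<lambda>(k, j). hermite_fun k (x j) / d j)"
    and D: "?D = mat N N (\<lambda>(i, j). if i = j then d j else 0)"
    unfolding hermite_Q_def hermite_D_def d_def N diff_Suc_1 by (rule refl)+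
  have QtQ: "transpose_mat ?Q * ?Q = 1\<^sub>m N"
    by (rule eq_matI)
      (auto simp: Q scalar_prod_def sum_divide_distrib[symmetric] inner d_nz)
  then have QQt: "?Q * transpose_mat ?Q = 1\<^sub>m N"
    using carrier by (metis mat_mult_left_right_inverse transpose_carrier_mat)
  have DE: "?D * E = 1\<^sub>m N"
    unfolding D diag_mult_mat[OF carrier(4)] by (rule eq_matI) (auto simp: E_def d_nz)
  have ED: "E * ?D = 1\<^sub>m N"
    unfolding E_def diag_mult_mat[OF carrier(3)] by (rule eq_matI) (auto simp: D d_nz)
  have Qt: "transpose_mat ?Q \<in> carrier_mat N N" and QE: "?Q * E \<in> carrier_mat N N"
    using carrier by auto
  have T: "?T = ?D * transpose_mat ?Q"
    unfolding D diag_mult_mat[OF Qt]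
    by (rule eq_matI) (auto simp: hermite_T_def Q d_nz)
  \<comment> \<open>\<open>T (Q E) = D (Q\<^sup>T Q) E = D E = 1\<close>; the other side holds since \<open>T\<close> is square.\<close>
  have "?T * (?Q * E) = ?D * (transpose_mat ?Q * (?Q * E))"
    unfolding T by (rule assoc_mult_mat[OF carrier(3) Qt QE])
  also have "transpose_mat ?Q * (?Q * E) = transpose_mat ?Q * ?Q * E"
    by (rule assoc_mult_mat[OF Qt carrier(2,4), symmetric])
  finally have TQE: "?T * (?Q * E) = 1\<^sub>m N"
    using carrier by (simp add: QtQ DE)
  then have QET: "?Q * E * ?T = 1\<^sub>m N"
    using carrier QE by (metis mat_mult_left_right_inverse)
  have "real_orthogonal_mat ?Q"
    using carrier QtQ QQt by (simp add: real_orthogonal_mat_def inverts_mat_def)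
  moreover have "diagonal_mat ?D"
    by (simp add: diagonal_mat_def hermite_D_def)
  moreover have "invertible_mat ?T"
    using carrier QE TQE QET unfolding invertible_mat_def inverts_mat_def
    by (metis carrier_matD square_mat.elims(3))
  moreover have "invertible_mat ?D"
    using carrier DE ED unfolding invertible_mat_def inverts_mat_def
    by (metis carrier_matD square_mat.elims(3))
  moreover have "inv_mat ?T = ?Q * inv_mat ?D"
    using inv_mat_eqI[OF carrier(1) QE TQE QET] inv_mat_eqI[OF carrier(3,4) DE ED] by simp
  ultimately show ?thesis using T by blast
qed

end
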